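(* Let the system $(A,B)$, the Markov process with kernels $\mathbb{P}_t(s'|s)=\phi(s)^{\mathsf T}\mu_t(s')$, the quadratic cost $c$ with weight blocks $W,F,D,M,H,R$, and the optimal state-action value functions $Q_t^*$ be as described in the context. Let $G_t$, $t\in\{0,\dots,T\}$, be given by $G_T=W$ and $$G_t=A^{\mathsf T}G_{t+1}A+W-(A^{\mathsf T}G_{t+1}B+D)(R+B^{\mathsf T}G_{t+1}B)^{-1}(B^{\mathsf T}G_{t+1}A+D^{\mathsf T}),$$ and let $\overline h_{i,t+1}\in\mathbb{R}^n$, $\overline q_{i,t+1}\in\mathbb{R}$ ($i=1,\dots,d$, $t\in\{0,\dots,T-1\}$) be parameters such that, for all $x\in\mathbb{R}^n$, $s\in\mathcal S$, $u\in\mathbb{R}^m$, $$Q_t^*(x,s,u)=c(x,s,u)+(Ax+Bu)^{\mathsf T}G_{t+1}(Ax+Bu)+\sum_{i=1}^d\phi_i(s)\big(2(Ax+Bu)^{\mathsf T}\overline h_{i,t+1}+\overline q_{i,t+1}\big).$$ Then for any $x\in\mathbb{R}^n$, $s\in\mathcal S$ and $t\in\{0,1,\dots,T-1\}$, the optimal policy (the minimizer of $u\mapsto Q_t^*(x,s,u)$) is $$u_t^*(x,s)=\pi_t^*(x,s)=K_{t,x}x+K_{t,s}s+K_{t,h}\sum_{i=1}^d\phi_i(s)\overline h_{i,t+1},$$ where $$K_{t,x}=-(R+B^{\mathsf T}G_{t+1}B)^{-1}(B^{\mathsf T}G_{t+1}A+D^{\mathsf T}),\quad K_{t,s}=-(R+B^{\mathsf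 T}G_{t+1}B)^{-1}H^{\mathsf T},\quad K_{t,h}=-(R+B^{\mathsf T}G_{t+1}B)^{-1}B^{\mathsf T}.$$
   Context: System: $x_{t+1}=Ax_t+Bu_t$ for $t\in\{0,\dots,T-1\}$, with $x_t\in\mathbb{R}^n$, $u_t\in\mathbb{R}^m$, $x_0\sim\mathcal N(0,\Sigma_x)$, $\Sigma_x\succ0$, and $(A,B)$ controllable. Environment: a Markov process with $s_{t+1}|s_t\sim\mathbb{P}_t(\cdot|s_t)$, $s_t\in\mathcal S\subset\mathbb{R}^p$, $s_0\sim\mu_0$ (a probability distribution on $\mathcal S$); it is not affected by $x_t$ or $u_t$. Linear Markov Process assumption: there are a map $\phi:\mathcal S\to\mathbb{R}^d$ and vectors $\mu_t=(\mu_{1,t},\dots,\mu_{d,t})$ of $d$ (finite) signed measures on $\mathcal S$ with $\mathbb{P}_t(\mathrm{d}s'|s)=\sum_{i=1}^d\phi_i(s)\mu_{i,t}(\mathrm{d}s')$. Moreover $\|\phi(s)\|\le1/\sqrt d$ and $\|s\|\le\delta_s$ for all $s\in\mathcal S$, and $\mathbb{E}[\phi(s_t)\phi(s_t)^{\mathsf T}]\succ0$ for all $t$. All maps are measurable. Quadratic Cost assumption: $$c(x,s,u)=\begin{bmatrix} x \\ s \\ u \end{bmatrix}^{\mathsf T}P\begin{bmatrix} x \\ s \\ u \end{bmatrix},\quad P=\begin{bmatrix} W & F & D \\ F^{\mathsf T} & M & H \\ D^{\mathsf T} & H^{\mathsf T} & R \end{bmatrix}\succeq0,\quad R\succ0,$$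 and $(A,W^{1/2})$ is observable. Control problem: minimize $\mathbb{E}[\sum_{t=0}^Tc(x_t,s_t,u_t)]$ over deterministic policies $u_t=\pi_t(x_t,s_t)$, with the convention $u_T=\pi_T(x_T,s_T)=0$. The optimal value functions satisfy $V_T^*(x,s)=c(x,s,0)$ and, for $t\in\{0,\dots,T-1\}$, $Q_t^*(x,s,u)=c(x,s,u)+\mathbb{E}_{s'\sim\mathbb{P}_t(\cdot|s)}[V_{t+1}^*(Ax+Bu,s')]$, $V_t^*(x,s)=\min_uQ_t^*(x,s,u)$; the optimal policy is $\pi_t^*(x,s)=\arg\min_uQ_t^*(x,s,u)$. *)

theory Defs
  imports "HOL-Probability.Probability"
begin

section \<open>Matrices\<close>

definition psd :: "real^'k^'k \<Rightarrow> bool" where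
  "psd X \<longleftrightarrow> transpose X = X \<and> (\<forall>v. 0 \<le> v \<bullet> (X *v v))"

definition posdef :: "real^'k^'k \<Rightarrow> bool" where
  "posdef X \<longleftrightarrow> transpose X = X \<and> (\<forall>v. v \<noteq> 0 \<longrightarrow> 0 < v \<bullet> (X *v v))"

definition psd_sqrt :: "real^'k^'k \<Rightarrow> real^'k^'k" where
  "psd_sqrt X = (THE Y. psd Y \<and> Y ** Y = X)"

text \<open>Kalman rank conditions: the block matrix with block columns \<open>A\<^sup>k B\<close> (block rows
  \<open>C A\<^sup>k\<close>), \<open>k < n\<close>, has rank \<open>n\<close>. Its rank is the dimension of the span of the union of
  the columns (rows) of the blocks.\<close>

definition controllable :: "real^'n^'n \<Rightarrow> real^'m^'n \<Rightarrow> bool" where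
  "controllable A B \<longleftrightarrow>
     dim (\<Union>k<CARD('n). columns (((\<lambda>X. A ** X) ^^ k) B)) = CARD('n)"

definition observable :: "real^'n^'n \<Rightarrow> real^'n^'r \<Rightarrow> bool" where
  "observable A C \<longleftrightarrow>
     dim (\<Union>k<CARD('n). rows (((\<lambda>X. X ** A) ^^ k) C)) = CARD('n)"

section \<open>Quadratic stage cost\<close>

definition block_vec :: "real^'n \<Rightarrow> real^'p \<Rightarrow> real^'m \<Rightarrow> real^('n + 'p + 'm)" where
  "block_vec x s u = (\<chi> i. case i of Inl a \<Rightarrow> x $ a
     | Inr (Inl b) \<Rightarrow> s $ b | Inr (Inr c) \<Rightarrow> u $ c)"

text \<open>The rows of the matrix with block rows \<open>[W F D]\<close>, \<open>[F\<^sup>T M H]\<close>, \<open>[D\<^sup>T H\<^sup>T R]\<close>.\<close>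

definition cost_matrix ::
  "real^'n^'n \<Rightarrow> real^'p^'n \<Rightarrow> real^'m^'n \<Rightarrow> real^'p^'p \<Rightarrow> real^'m^'p \<Rightarrow> real^'m^'m
     \<Rightarrow> real^('n + 'p + 'm)^('n + 'p + 'm)" where
  "cost_matrix W F D M H R = (\<chi> i. case i of
       Inl a \<Rightarrow> block_vec (W $ a) (F $ a) (D $ a)
     | Inr (Inl b) \<Rightarrow> block_vec (transpose F $ b) (M $ b) (H $ b)
     | Inr (Inr c) \<Rightarrow> block_vec (transpose D $ c) (transpose H $ c) (R $ c))"

definition quad_cost ::
  "real^'n^'n \<Rightarrow> real^'p^'n \<Rightarrow> real^'m^'n \<Rightarrow> real^'p^'p \<Rightarrow> real^'m^'p \<Rightarrow> real^'m^'m
     \<Rightarrow> real^'n \<Rightarrow> real^'p \<Rightarrow> real^'m \<Rightarrow> real" where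
  "quad_cost W F D M H R x s u =
     block_vec x s u \<bullet> (cost_matrix W F D M H R *v block_vec x s u)"

section \<open>Probabilistic notions\<close>

definition centered_normal_density :: "real^'n^'n \<Rightarrow> real^'n \<Rightarrow> real" where
  "centered_normal_density \<Sigma> x =
     exp (- (x \<bullet> (matrix_inv \<Sigma> *v x)) / 2) / sqrt ((2 * pi) ^ CARD('n) * det \<Sigma>)"

text \<open>Only the measurable space underlying \<open>N\<close> is used; finiteness is built into the real range.\<close>

definition signed_measure_on :: "'a measure \<Rightarrow> ('a set \<Rightarrow> real) \<Rightarrow> bool" where
  "signed_measure_on N \<nu> \<longleftrightarrow> \<nu> {} = 0 \<and>
     (\<forall>E :: nat \<Rightarrow> 'a set. range E \<subseteq> sets N \<longrightarrow> disjoint_family E \<longrightarrow>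
        (\<lambda>k. \<nu> (E k)) sums \<nu> (\<Union>k. E k))"

text \<open>The sigma-algebra generated by \<open>x\<^sub>0, s\<^sub>0, \<dots>, s\<^sub>t\<close>. Under a deterministic policy it
  also determines \<open>x\<^sub>1, \<dots>, x\<^sub>t\<close> and \<open>u\<^sub>0, \<dots>, u\<^sub>t\<close>.\<close>

definition history ::
  "'w measure \<Rightarrow> (real^'p) set \<Rightarrow> ('w \<Rightarrow> real^'n) \<Rightarrow> (nat \<Rightarrow> 'w \<Rightarrow> real^'p) \<Rightarrow> nat \<Rightarrow> 'w measure"
  where
  "history \<Omega> S x0 s t = sigma (space \<Omega>)
     ({x0 -` E \<inter> space \<Omega> | E. E \<in> sets borel} \<union>
      {s k -` E \<inter> space \<Omega> | k E. k \<le> t \<and> E \<in> sets (restrict_space borel S)})"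

text \<open>Environment with transition kernels \<open>P\<^sub>t\<close> on \<open>S\<close> and initial law \<open>\<mu>0\<close>, up to time \<open>T\<close>.
  Conditioning on \<open>x\<^sub>0\<close> as well as on \<open>s\<^sub>0, \<dots>, s\<^sub>t\<close> expresses that the transitions are not
  affected by the system state or the input.\<close>

definition markov_environment ::
  "'w measure \<Rightarrow> (real^'p) set \<Rightarrow> ('w \<Rightarrow> real^'n) \<Rightarrow> (nat \<Rightarrow> 'w \<Rightarrow> real^'p) \<Rightarrow> (real^'p) measure
     \<Rightarrow> (nat \<Rightarrow> real^'p \<Rightarrow> (real^'p) measure) \<Rightarrow> nat \<Rightarrow> bool" where
  "markov_environment \<Omega> S x0 s \<mu>0 P T \<longleftrightarrow>
     \<mu>0 \<in> space (prob_algebra (restrict_space borel S)) \<and>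
     (\<forall>t<T. P t \<in> restrict_space borel S \<rightarrow>\<^sub>M prob_algebra (restrict_space borel S)) \<and>
     (\<forall>t\<le>T. s t \<in> \<Omega> \<rightarrow>\<^sub>M restrict_space borel S) \<and>
     distr \<Omega> (restrict_space borel S) (s 0) = \<mu>0 \<and>
     (\<forall>t<T. \<forall>E\<in>sets (restrict_space borel S). AE \<omega> in \<Omega>.
        real_cond_exp \<Omega> (history \<Omega> S x0 s t) (\<lambda>\<omega>. indicator E (s (Suc t) \<omega>)) \<omega>
          = measure (P t (s t \<omega>)) E)"

text \<open>Linear Markov process with feature map \<open>\<phi>\<close>; \<open>\<mu> t i\<close> is the \<open>i\<close>-th signed measure at \<open>t\<close>.\<close>

definition linear_markov ::
  "'w measure \<Rightarrow> (real^'p) set \<Rightarrow> (nat \<Rightarrow> 'w \<Rightarrow> real^'p)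
     \<Rightarrow> (nat \<Rightarrow> real^'p \<Rightarrow> (real^'p) measure) \<Rightarrow> nat
     \<Rightarrow> (real^'p \<Rightarrow> real^'d) \<Rightarrow> (nat \<Rightarrow> 'd \<Rightarrow> (real^'p) set \<Rightarrow> real) \<Rightarrow> real \<Rightarrow> bool" where
  "linear_markov \<Omega> S s P T \<phi> \<mu> \<delta> \<longleftrightarrow>
     \<phi> \<in> borel_measurable (restrict_space borel S) \<and>
     (\<forall>t<T. \<forall>i. signed_measure_on (restrict_space borel S) (\<mu> t i)) \<and>
     (\<forall>t<T. \<forall>z\<in>S. \<forall>E\<in>sets (restrict_space borel S).
        measure (P t z) E = (\<Sum>i\<in>UNIV. \<phi> z $ i * \<mu> t i E)) \<and>
     (\<forall>z\<in>S. norm (\<phi> z) \<le> 1 / sqrt (real CARD('d)) \<and> norm z \<le> \<delta>) \<and>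
     (\<forall>t\<le>T. posdef (\<chi> i j. \<integral>\<omega>. \<phi> (s t \<omega>) $ i * \<phi> (s t \<omega>) $ j \<partial>\<Omega>))"

section \<open>Optimal value functions\<close>

text \<open>Throughout, \<open>c\<close> is the stage cost and \<open>P t s\<close> the law of the next environment state.\<close>

definition bellman_Q ::
  "real^'n^'n \<Rightarrow> real^'m^'n \<Rightarrow> (real^'n \<Rightarrow> real^'p \<Rightarrow> real^'m \<Rightarrow> real)
     \<Rightarrow> (real^'p \<Rightarrow> (real^'p) measure) \<Rightarrow> (real^'n \<Rightarrow> real^'p \<Rightarrow> real)
     \<Rightarrow> real^'n \<Rightarrow> real^'p \<Rightarrow> real^'m \<Rightarrow> real" where
  "bellman_Q A B c K V x s u = c x s u + (\<integral>s'. V (A *v x + B *v u) s' \<partial>K s)"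

text \<open>\<open>value_to_go\<close> is indexed by the number of remaining steps \<open>T - t\<close>. The minimum over \<open>u\<close> is
  written as an infimum, with which it agrees whenever it is attained.\<close>

primrec value_to_go ::
  "real^'n^'n \<Rightarrow> real^'m^'n \<Rightarrow> (real^'n \<Rightarrow> real^'p \<Rightarrow> real^'m \<Rightarrow> real)
     \<Rightarrow> (nat \<Rightarrow> real^'p \<Rightarrow> (real^'p) measure) \<Rightarrow> nat \<Rightarrow> nat
     \<Rightarrow> real^'n \<Rightarrow> real^'p \<Rightarrow> real" where
  "value_to_go A B c P T 0 = (\<lambda>x s. c x s 0)"
| "value_to_go A B c P T (Suc k) =
     (\<lambda>x s. INF u. bellman_Q A B c (P (T - Suc k)) (value_to_go A B c P T k) x s u)"

definition opt_V ::
  "real^'n^'n \<Rightarrow> real^'m^'n \<Rightarrow> (real^'n \<Rightarrow> real^'p \<Rightarrow> real^'m \<Rightarrow> real)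
     \<Rightarrow> (nat \<Rightarrow> real^'p \<Rightarrow> (real^'p) measure) \<Rightarrow> nat \<Rightarrow> nat
     \<Rightarrow> real^'n \<Rightarrow> real^'p \<Rightarrow> real" where
  "opt_V A B c P T t = value_to_go A B c P T (T - t)"

definition opt_Q ::
  "real^'n^'n \<Rightarrow> real^'m^'n \<Rightarrow> (real^'n \<Rightarrow> real^'p \<Rightarrow> real^'m \<Rightarrow> real)
     \<Rightarrow> (nat \<Rightarrow> real^'p \<Rightarrow> (real^'p) measure) \<Rightarrow> nat \<Rightarrow> nat
     \<Rightarrow> real^'n \<Rightarrow> real^'p \<Rightarrow> real^'m \<Rightarrow> real" where
  "opt_Q A B c P T t = bellman_Q A B c (P t) (opt_V A B c P T (Suc t))"

definition opt_policy ::
  "real^'n^'n \<Rightarrow> real^'m^'n \<Rightarrow> (real^'n \<Rightarrow> real^'p \<Rightarrow> real^'m \<Rightarrow> real)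
     \<Rightarrow> (nat \<Rightarrow> real^'p \<Rightarrow> (real^'p) measure) \<Rightarrow> nat \<Rightarrow> nat
     \<Rightarrow> real^'n \<Rightarrow> real^'p \<Rightarrow> real^'m" where
  "opt_policy A B c P T t x s = arg_min (opt_Q A B c P T t x s) (\<lambda>_. True)"

lemma opt_V_final: "opt_V A B c P T T x s = c x s 0"
  by (simp add: opt_V_def)

lemma opt_V_step:
  assumes "t < T"
  shows "opt_V A B c P T t x s = (INF u. opt_Q A B c P T t x s u)"
proof -
  have "T - t = Suc (T - Suc t)" "T - Suc (T - Suc t) = t"
    using assms by auto
  then show ?thesis
    by (simp add: opt_V_def opt_Q_def)
qed

lemma opt_Q_step:
  "opt_Q A B c P T t x s u =
     c x s u + (\<integral>s'. opt_V A B c P T (Suc t) (A *v x + B *v u) s' \<partial>P t s)"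
  by (simp add: opt_Q_def bellman_Q_def)

end

theory Submission
  imports Defs
begin

text \<open>With \<open>N\<^sub>t = R + B\<^sup>T G\<^bsub>t+1\<^esub> B\<close>, the given form of \<open>Q\<^sub>t\<close> is, for fixed \<open>x\<close> and \<open>s\<close>, a quadratic
  polynomial \<open>u \<bullet> N\<^sub>t u + 2 u \<bullet> b + a\<close> in the input, where
  \<open>b = (B\<^sup>T G\<^bsub>t+1\<^esub> A + D\<^sup>T) x + H\<^sup>T s + B\<^sup>T (\<Sum>\<^sub>i \<phi>\<^sub>i(s) h\<^sub>i)\<close>. If \<open>N\<^sub>t\<close> is positive definite, completing
  the square (\<open>complete_square\<close>) shows that \<open>- N\<^sub>t\<^sup>-\<^sup>1 b\<close> is the one and only minimizer
  (\<open>is_arg_min_quadratic_iff\<close>), and this is the asserted feedback law.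

  Since \<open>R\<close> is positive definite, it remains to see that every \<open>G\<^sub>t\<close> is positive semidefinite. This goes
  backwards in time from \<open>G\<^sub>T = W\<close>. The Riccati map sends \<open>G\<close> to the Schur complement of \<open>N\<close> in
  the matrix of the quadratic form \<open>(x, u) \<mapsto> c(x, 0, u) + (Ax + Bu) \<bullet> G (Ax + Bu)\<close>;
  so the new quadratic form is the minimum over \<open>u\<close> of a nonnegative cost (\<open>psd_riccati_step\<close>).
  The environment state changes only the terms of \<open>Q\<^sub>t\<close> that are affine in \<open>u\<close>: it shifts the
  minimizer but leaves the curvature \<open>N\<^sub>t\<close> as it is.\<close>

section \<open>Minimizing quadratic polynomials\<close>

lemma inner_transpose_mult:
  fixes X :: "real^'k^'l"
  shows "y \<bullet> (transpose X *v x) = x \<bullet> (X *v y)"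
  by (simp add: dot_lmul_matrix inner_commute[of y])

lemma inner_congruence:
  fixes X :: "real^'k^'l" and Y :: "real^'i^'l" and Z :: "real^'j^'k"
  shows "v \<bullet> ((transpose Y ** X ** Z) *v w) = (Y *v v) \<bullet> (X *v (Z *v w))"
proof -
  have "(transpose Y ** X ** Z) *v w = transpose Y *v (X *v (Z *v w))"
    by (simp only: matrix_vector_mul_assoc matrix_mul_assoc)
  then show ?thesis
    by (simp only: inner_transpose_mult) (simp only: inner_commute)
qed

lemma inner_symmetric_matrix_commute:
  fixes X :: "real^'k^'k"
  assumes "transpose X = X"
  shows "x \<bullet> (X *v y) = y \<bullet> (X *v x)"
  using inner_transpose_mult[of x X y] by (simp only: assms)

lemma transpose_add:
  "transpose (X + Y) = transpose X + transpose (Y :: real^'k^'l)"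
  by (simp add: transpose_def vec_eq_iff)

lemma transpose_diff:
  "transpose (X - Y) = transpose X - transpose (Y :: real^'k^'l)"
  by (simp add: transpose_def vec_eq_iff)

lemma transpose_congruence:
  fixes X :: "real^'k^'k" and Y :: "real^'l^'k"
  assumes "transpose X = X"
  shows "transpose (transpose Y ** X ** Y) = transpose Y ** X ** Y"
  by (simp add: matrix_transpose_mul assms matrix_mul_assoc)

lemma matrix_vector_mult_uminus:
  "(- X) *v v = - ((X :: real^'k^'l) *v v)"
  by (simp add: matrix_vector_mult_def vec_eq_iff sum_negf)

lemma posdef_invertible:
  assumes "posdef X"
  shows "invertible X"
proof -
  have "v = 0" if "X *v v = 0" for v
    using assms that unfolding posdef_def by force
  then show ?thesis
    by (simp add: invertible_left_inverse matrix_left_invertible_ker)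
qed

lemma posdef_matrix_mult_inverse:
  assumes "posdef X"
  shows "X ** matrix_inv X = mat 1"
  using posdef_invertible[OF assms] unfolding invertible_def matrix_inv_def
  by (rule someI2_ex) simp

lemma posdef_mult_inverse:
  assumes "posdef X"
  shows "X *v (matrix_inv X *v v) = v"
  using posdef_matrix_mult_inverse[OF assms]
  by (simp add: matrix_vector_mul_assoc)

lemma posdef_inverse_symmetric:
  assumes "posdef X"
  shows "transpose (matrix_inv X) = matrix_inv X"
proof -
  have sym: "transpose X = X"
    using assms by (simp add: posdef_def)
  have "transpose (matrix_inv X) ** X = transpose (X ** matrix_inv X)"
    by (simp add: matrix_transpose_mul sym)
  also have "\<dots> = mat 1"
    using posdef_matrix_mult_inverse[OF assms] by simp
  finally have left: "transpose (matrix_inv X) ** X = mat 1" .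
  have "transpose (matrix_inv X) = transpose (matrix_inv X) ** (X ** matrix_inv X)"
    using posdef_matrix_mult_inverse[OF assms] by simp
  also have "\<dots> = matrix_inv X"
    by (simp add: matrix_mul_assoc left)
  finally show ?thesis .
qed

lemma posdef_add_psd:
  assumes "posdef X" and "psd Y"
  shows "posdef (X + Y)"
  using assms unfolding posdef_def psd_def
  by (auto simp: transpose_add matrix_vector_mult_add_rdistrib inner_add_right
      intro: add_pos_nonneg)

lemma psd_congruence:
  fixes Y :: "real^'l^'k"
  assumes "psd X"
  shows "psd (transpose Y ** X ** Y)"
  using assms by (simp add: psd_def transpose_congruence inner_congruence)

lemma complete_square:
  assumes "posdef N"
  shows "u \<bullet> (N *v u) + 2 * (u \<bullet> b)
    = (u + matrix_inv N *v b) \<bullet> (N *v (u + matrix_inv N *v b)) - b \<bullet> (matrix_inv N *v b)"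
proof -
  have "(matrix_inv N *v b) \<bullet> (N *v u) = u \<bullet> b"
    using inner_symmetric_matrix_commute[of N u "matrix_inv N *v b"] assms
    by (simp add: posdef_def posdef_mult_inverse)
  then show ?thesis
    by (simp add: matrix_vector_right_distrib posdef_mult_inverse[OF assms]
        inner_add_left inner_add_right inner_commute[of b])
qed

lemma is_arg_min_quadratic_iff:
  assumes N: "posdef N" and f: "\<And>u. f u = u \<bullet> (N *v u) + 2 * (u \<bullet> b) + a"
  shows "is_arg_min f (\<lambda>_. True) u \<longleftrightarrow> u = - (matrix_inv N *v b)"
proof -
  let ?m = "- (matrix_inv N *v b)"
  have f_eq: "f v = f ?m + (v - ?m) \<bullet> (N *v (v - ?m))" for v
    using complete_square[OF N, of v b] complete_square[OF N, of ?m b] by (simp add: f)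
  have less: "f ?m < f v" if "v \<noteq> ?m" for v
  proof -
    have "v - ?m \<noteq> 0" using that by (metis eq_iff_diff_eq_0)
    then show ?thesis
      using N f_eq[of v] unfolding posdef_def by force
  qed
  show ?thesis
    unfolding is_arg_min_def using less by (metis less_asym)
qed

section \<open>The stage cost\<close>

lemma sum_UNIV_Plus:
  fixes f :: "'a::finite + 'b::finite \<Rightarrow> real"
  shows "(\<Sum>i\<in>UNIV. f i) = (\<Sum>a\<in>UNIV. f (Inl a)) + (\<Sum>b\<in>UNIV. f (Inr b))"
  by (simp add: UNIV_Plus_UNIV[symmetric] sum.Plus del: UNIV_Plus_UNIV)

lemma inner_block_vec:
  "block_vec x s u \<bullet> block_vec x' s' u' = x \<bullet> x' + s \<bullet> s' + u \<bullet> u'"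
  by (simp add: inner_vec_def sum_UNIV_Plus block_vec_def)

lemma block_vec_nth:
  "block_vec x s u $ Inl a = x $ a"
  "block_vec x s u $ Inr (Inl b) = s $ b"
  "block_vec x s u $ Inr (Inr c) = u $ c"
  by (simp_all add: block_vec_def)

lemma cost_matrix_mult_block_vec:
  "cost_matrix W F D M H R *v block_vec x s u
    = block_vec (W *v x + F *v s + D *v u)
        (transpose F *v x + M *v s + H *v u)
        (transpose D *v x + transpose H *v s + R *v u)"
proof -
  have "(cost_matrix W F D M H R *v block_vec x s u) $ i
    = block_vec (W *v x + F *v s + D *v u)
        (transpose F *v x + M *v s + H *v u)
        (transpose D *v x + transpose H *v s + R *v u) $ i" for i
  proof -
    consider a where "i = Inl a" | b where "i = Inr (Inl b)" | c where "i = Inr (Inr c)"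
      by (metis sum.exhaust)
    then show ?thesis
      by cases
        (simp_all add: cost_matrix_def inner_block_vec block_vec_nth matrix_vector_mul_component
          del: transpose_matrix_vector)
  qed
  then show ?thesis by (simp add: vec_eq_iff)
qed

lemma quad_cost_eq:
  "quad_cost W F D M H R x s u = x \<bullet> (W *v x) + s \<bullet> (M *v s) + u \<bullet> (R *v u)
    + 2 * (x \<bullet> (F *v s)) + 2 * (x \<bullet> (D *v u)) + 2 * (s \<bullet> (H *v u))"
  unfolding quad_cost_def cost_matrix_mult_block_vec inner_block_vec inner_add_right
    inner_transpose_mult
  by simp

lemma psd_cost_matrix_nonneg:
  assumes "psd (cost_matrix W F D M H R)"
  shows "0 \<le> quad_cost W F D M H R x s u"
  using assms by (simp add: psd_def quad_cost_def)

lemma psd_cost_matrix_state_block: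
  assumes "psd (cost_matrix W F D M H R)"
  shows "psd W"
proof -
  have "transpose W $ a $ b = W $ a $ b" for a b
  proof -
    have "transpose (cost_matrix W F D M H R) $ Inl a $ Inl b
      = cost_matrix W F D M H R $ Inl a $ Inl b"
      using assms by (simp add: psd_def)
    then show ?thesis
      by (simp add: cost_matrix_def block_vec_def transpose_def)
  qed
  moreover have "0 \<le> x \<bullet> (W *v x)" for x
    using psd_cost_matrix_nonneg[OF assms, of x 0 0] by (simp add: quad_cost_eq)
  ultimately show ?thesis
    by (simp add: psd_def vec_eq_iff)
qed

section \<open>The Riccati recursion\<close>

text \<open>Sorting the terms by their degree in \<open>u\<close> brings the cost into the form to which
  \<open>complete_square\<close> applies.\<close>

lemma successor_form_eq:
  fixes A :: "real^'n^'n" and B :: "real^'m^'n"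
  assumes "transpose G = G"
  shows "(A *v x + B *v u) \<bullet> (G *v (A *v x + B *v u)) + u \<bullet> (R *v u) + 2 * (x \<bullet> (D *v u))
    = u \<bullet> ((R + transpose B ** G ** B) *v u)
      + 2 * (u \<bullet> ((transpose B ** G ** A + transpose D) *v x))
      + x \<bullet> ((transpose A ** G ** A) *v x)"
  using inner_symmetric_matrix_commute[OF assms, of "A *v x" "B *v u"]
  unfolding matrix_vector_mult_add_rdistrib inner_add_right inner_congruence inner_transpose_mult
    matrix_vector_right_distrib inner_add_left
  by simp

text \<open>At the minimizing input the one-step cost with \<open>s = 0\<close> equals the quadratic form of the
  Riccati update, so that form inherits nonnegativity from the cost.\<close>

lemma psd_riccati_step:
  fixes A :: "real^'n^'n" and B :: "real^'m^'n"
  assumes cost: "psd (cost_matrix W F D M H R)" and R: "posdef R" and G: "psd G"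
  shows "psd (transpose A ** G ** A + W
    - (transpose A ** G ** B + D) ** matrix_inv (R + transpose B ** G ** B)
        ** (transpose B ** G ** A + transpose D))" (is "psd ?G'")
proof -
  define N where "N = R + transpose B ** G ** B"
  define L where "L = transpose B ** G ** A + transpose D"
  have N: "posdef N"
    unfolding N_def by (intro posdef_add_psd psd_congruence R G)
  have symG: "transpose G = G" using G by (simp add: psd_def)
  have W: "psd W" by (rule psd_cost_matrix_state_block[OF cost])
  have L': "transpose A ** G ** B + D = transpose L"
    by (simp add: L_def transpose_add matrix_transpose_mul symG matrix_mul_assoc)
  have G': "?G' = transpose A ** G ** A + W - transpose L ** matrix_inv N ** L"
    unfolding L' by (simp add: N_def L_def)
  have sym: "transpose ?G' = ?G'"
    unfolding G' using W
    by (simp add: transpose_diff transpose_add psd_def transpose_congruence symG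
        posdef_inverse_symmetric[OF N])
  have "0 \<le> x \<bullet> (?G' *v x)" for x
  proof -
    define u where "u = - (matrix_inv N *v (L *v x))"
    have square: "u \<bullet> (N *v u) + 2 * (u \<bullet> (L *v x)) = - ((L *v x) \<bullet> (matrix_inv N *v (L *v x)))"
      using complete_square[OF N, of u "L *v x"] by (simp add: u_def)
    have "x \<bullet> (?G' *v x) = x \<bullet> ((transpose A ** G ** A) *v x) + x \<bullet> (W *v x)
        - (L *v x) \<bullet> (matrix_inv N *v (L *v x))"
      unfolding G' matrix_vector_mult_add_rdistrib matrix_vector_mult_diff_rdistrib
        inner_add_right inner_diff_right inner_congruence ..
    also have "\<dots> = quad_cost W F D M H R x 0 u
        + (A *v x + B *v u) \<bullet> (G *v (A *v x + B *v u))"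
      using successor_form_eq[OF symG, of A x B u R D] square
      by (simp add: quad_cost_eq N_def L_def)
    also have "\<dots> \<ge> 0"
      using psd_cost_matrix_nonneg[OF cost] G by (simp add: psd_def)
    finally show ?thesis .
  qed
  with sym show ?thesis by (simp add: psd_def)
qed

section \<open>The optimal policy\<close>

theorem mainTheorem2:
  fixes A :: "real^'n^'n" and B :: "real^'m^'n" and T :: nat
    and \<Omega> :: "'w measure" and x0 :: "'w \<Rightarrow> real^'n" and \<Sigma>\<^sub>x :: "real^'n^'n"
    and S :: "(real^'p) set" and s_proc :: "nat \<Rightarrow> 'w \<Rightarrow> real^'p"
    and \<mu>0 :: "(real^'p) measure" and P :: "nat \<Rightarrow> real^'p \<Rightarrow> (real^'p) measure"
    and \<phi> :: "real^'p \<Rightarrow> real^'d" and \<mu> :: "nat \<Rightarrow> 'd \<Rightarrow> (real^'p) set \<Rightarrow> real" and \<delta>\<^sub>s :: real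
    and W :: "real^'n^'n" and F :: "real^'p^'n" and D :: "real^'m^'n"
    and M :: "real^'p^'p" and H :: "real^'m^'p" and R :: "real^'m^'m"
    and c :: "real^'n \<Rightarrow> real^'p \<Rightarrow> real^'m \<Rightarrow> real"
    and G :: "nat \<Rightarrow> real^'n^'n"
    and h :: "'d \<Rightarrow> nat \<Rightarrow> real^'n" and q :: "'d \<Rightarrow> nat \<Rightarrow> real"
    and Kx :: "nat \<Rightarrow> real^'n^'m" and Ks :: "nat \<Rightarrow> real^'p^'m" and Kh :: "nat \<Rightarrow> real^'n^'m"
  assumes prob: "prob_space \<Omega>"
    and Sigma_x: "posdef \<Sigma>\<^sub>x"
    and x0: "distributed \<Omega> lborel x0 (\<lambda>x. ennreal (centered_normal_density \<Sigma>\<^sub>x x))"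
    and controllable: "controllable A B"
    and environment: "markov_environment \<Omega> S x0 s_proc \<mu>0 P T"
    and linear_markov: "linear_markov \<Omega> S s_proc P T \<phi> \<mu> \<delta>\<^sub>s"
    and cost: "c = quad_cost W F D M H R"
    and cost_psd: "psd (cost_matrix W F D M H R)"
    and R_posdef: "posdef R"
    and observable: "observable A (psd_sqrt W)"
    and G_final: "G T = W"
    and G_step: "\<And>t. t < T \<Longrightarrow> G t = transpose A ** G (t + 1) ** A + W
        - (transpose A ** G (t + 1) ** B + D) ** matrix_inv (R + transpose B ** G (t + 1) ** B)
            ** (transpose B ** G (t + 1) ** A + transpose D)"
    and Q_form: "\<And>t x s u. t < T \<Longrightarrow> s \<in> S \<Longrightarrow>
        opt_Q A B c P T t x s u = c x s u
          + (A *v x + B *v u) \<bullet> (G (t + 1) *v (A *v x + B *v u))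
          + (\<Sum>i\<in>UNIV. \<phi> s $ i * (2 * ((A *v x + B *v u) \<bullet> h i (t + 1)) + q i (t + 1)))"
    and Kx: "\<And>t. t < T \<Longrightarrow> Kx t = - (matrix_inv (R + transpose B ** G (t + 1) ** B)
        ** (transpose B ** G (t + 1) ** A + transpose D))"
    and Ks: "\<And>t. t < T \<Longrightarrow> Ks t = - (matrix_inv (R + transpose B ** G (t + 1) ** B)
        ** transpose H)"
    and Kh: "\<And>t. t < T \<Longrightarrow> Kh t = - (matrix_inv (R + transpose B ** G (t + 1) ** B)
        ** transpose B)"
  shows "\<forall>x. \<forall>s\<in>S. \<forall>t<T.
    (\<forall>u. is_arg_min (opt_Q A B c P T t x s) (\<lambda>_. True) u \<longleftrightarrow>
       u = Kx t *v x + Ks t *v s + Kh t *v (\<Sum>i\<in>UNIV. \<phi> s $ i *\<^sub>R h i (t + 1))) \<and>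
    opt_policy A B c P T t x s
      = Kx t *v x + Ks t *v s + Kh t *v (\<Sum>i\<in>UNIV. \<phi> s $ i *\<^sub>R h i (t + 1))"
proof (intro allI ballI impI)
  fix x :: "real^'n" and s :: "real^'p" and t :: nat
  assume s: "s \<in> S" and t: "t < T"
  have G_psd: "psd (G k)" if "k \<le> T" for k
    using that
  proof (induction rule: inc_induct)
    case base
    show ?case using psd_cost_matrix_state_block[OF cost_psd] by (simp add: G_final)
  next
    case (step k)
    then show ?case
      using psd_riccati_step[OF cost_psd R_posdef, of "G (k + 1)" A B] G_step[of k] by simp
  qed
  define N where "N = R + transpose B ** G (t + 1) ** B"
  define L where "L = transpose B ** G (t + 1) ** A + transpose D"
  define g where "g = (\<Sum>i\<in>UNIV. \<phi> s $ i *\<^sub>R h i (t + 1))"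
  define b where "b = L *v x + transpose H *v s + transpose B *v g"
  define a where "a = x \<bullet> ((transpose A ** G (t + 1) ** A) *v x) + x \<bullet> (W *v x) + s \<bullet> (M *v s)
    + 2 * (x \<bullet> (F *v s)) + 2 * ((A *v x) \<bullet> g) + (\<Sum>i\<in>UNIV. \<phi> s $ i * q i (t + 1))"
  have G: "psd (G (t + 1))" using G_psd t by simp
  have N: "posdef N"
    unfolding N_def by (intro posdef_add_psd psd_congruence R_posdef G)
  have quadratic: "opt_Q A B c P T t x s u = u \<bullet> (N *v u) + 2 * (u \<bullet> b) + a" for u
  proof -
    have environment_terms: "(\<Sum>i\<in>UNIV. \<phi> s $ i * (2 * ((A *v x + B *v u) \<bullet> h i (t + 1)) + q i (t + 1)))
        = 2 * ((A *v x + B *v u) \<bullet> g) + (\<Sum>i\<in>UNIV. \<phi> s $ i * q i (t + 1))"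
      by (simp add: g_def inner_sum_right sum_distrib_left distrib_left sum.distrib mult.left_commute)
    have B: "u \<bullet> (transpose B *v g) = (B *v u) \<bullet> g"
      by (simp only: inner_transpose_mult inner_commute)
    have "transpose (G (t + 1)) = G (t + 1)" using G by (simp add: psd_def)
    from successor_form_eq[OF this, of A x B u R D] show ?thesis
      unfolding Q_form[OF t s] environment_terms
      unfolding cost quad_cost_eq a_def b_def inner_add_right inner_add_left B
        inner_transpose_mult[of u H] N_def L_def
      by argo
  qed
  have minimizer: "- (matrix_inv N *v b) = Kx t *v x + Ks t *v s + Kh t *v g"
    unfolding Kx[OF t] Ks[OF t] Kh[OF t] b_def N_def[symmetric] L_def[symmetric]
    by (simp add: matrix_vector_mult_uminus matrix_vector_right_distrib
        del: transpose_matrix_vector flip: matrix_vector_mul_assoc)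
  have iff: "is_arg_min (opt_Q A B c P T t x s) (\<lambda>_. True) u
      \<longleftrightarrow> u = Kx t *v x + Ks t *v s + Kh t *v g" for u
    using is_arg_min_quadratic_iff[OF N quadratic] by (simp add: minimizer)
  moreover have "opt_policy A B c P T t x s = Kx t *v x + Ks t *v s + Kh t *v g"
    by (simp add: opt_policy_def arg_min_def iff)
  ultimately show "(\<forall>u. is_arg_min (opt_Q A B c P T t x s) (\<lambda>_. True) u \<longleftrightarrow>
      u = Kx t *v x + Ks t *v s + Kh t *v (\<Sum>i\<in>UNIV. \<phi> s $ i *\<^sub>R h i (t + 1))) \<and>
    opt_policy A B c P T t x s
      = Kx t *v x + Ks t *v s + Kh t *v (\<Sum>i\<in>UNIV. \<phi> s $ i *\<^sub>R h i (t + 1))"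
    unfolding g_def by blast
qed

end
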